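(* Let $[f_1\dots f_d]$, with $f_l:\mathbb{R}^d\to\mathbb{R}$ for $l=1,\dots,d$, be a one-dimensional governing equation with separation rank $N$ and interaction range $(s_1,s_2)$, and let $V$ be its leg embedding space (all notions as defined in the context). Then $f_l\in V^{\otimes d}$ for $l=1,\dots,d$, and: (i) The CP-rank of each $f_l$ is at most $N$. (ii) Each $f_l$ has a tensor train (TT) representation with ranks $r_k\le N$ for $l-s_1\le k<l+s_2$ and $r_k=1$ for all other $k\in\{1,\dots,d-1\}$. (iii) There is a selection tensor representation of $[f_1\dots f_d]$ with $n=s_1+s_2+2$ activation types and TT ranks bounded by $N$. (iv) The system $[f_1\dots f_d]$ has a single TT representation with ranks $r_k\le k-s_2+1+N(s_1+s_2)$ for $k\in\{1,\dots,d-1\}$.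
   Context: **One-dimensional interacting systems.** Let $d\ge 1$, $N\ge 1$ and $s_1,s_2\ge 0$ be integers. A system $[f_1\dots f_d]$ of functions $f_l:\mathbb{R}^d\to\mathbb{R}$ is called a one-dimensional governing equation with interaction range $(s_1,s_2)$ and separation rank $N$ if there exist univariate functions $g_1,\dots,g_{\bar p}:\mathbb{R}\to\mathbb{R}$ and, for each $l\in\{1,\dots,d\}$, an index set $\mathcal{I}_l\subset\{1,\dots,\bar p\}^{s_1+s_2+1}$ with $|\mathcal{I}_l|\le N$, such that $$f_l(x)=\sum_{(i_{l-s_1},\dots,i_{l+s_2})\in\mathcal{I}_l} g_{i_{l-s_1}}(x_{l-s_1})\cdots g_{i_{l+s_2}}(x_{l+s_2}),$$ where one sets $g_{i_k}=1$ (the factor is dropped) whenever $k\le 0$ or $k\ge d+1$. The leg embedding space $V$ is the univariate function space spanned by $g_1,\dots,g_{\bar p}$ together with the constant function $1$. **Tensor products of functions.** $V^{\otimes d}$ is identified with the linear span of the functions $(x_1,\dots,x_d)\mapsto v_1(x_1)\cdots v_d(x_d)$ with $v_1,\dots,v_d\in V$. Fix a basis $\psi_1,\dots,\psi_{\tilde p}$ of $V$. Each $f\in V^{\otimes d}$ is uniquely written as $f(x)=\sum_{i_1,\dots,i_d=1}^{\tilde p}\theta_{i_1\dots i_d}\psi_{i_1}(x_1)\cdots\psi_{i_d}(x_d)$ with coefficient tensor $\theta\in\mathbb{R}^{\tilde p\times\dots\times\tilde p}$. **CP-rank.** The CP-rank of $f\in V^{\otimes d}$ is the smallest number $r$ such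 that $f$ is a sum of $r$ functions of the form $v_1(x_1)\cdots v_d(x_d)$ with $v_k\in V$. **TT representation of a single function.** A TT representation of $f\in V^{\otimes d}$ with ranks $(r_1,\dots,r_{d-1})$ (and $r_0=r_d=1$) is a collection of core tensors $A^k\in\mathbb{R}^{r_{k-1}\times\tilde p\times r_k}$, $k=1,\dots,d$, such that $$\theta_{i_1\dots i_d}=\sum_{l_1=1}^{r_1}\cdots\sum_{l_{d-1}=1}^{r_{d-1}}A^1_{1,i_1,l_1}A^2_{l_1,i_2,l_2}\cdots A^d_{l_{d-1},i_d,1}.$$ **Selection tensor representation of a system.** A selection tensor representation of $[f_1\dots f_d]$ with $n$ activation types and TT ranks $(r_1,\dots,r_{d-1})$ ($r_0=r_d=1$) consists of an activation pattern $q_{kl}\in\{1,\dots,n\}$ for $k,l\in\{1,\dots,d\}$, encoded in the selection tensor $S=\sum_{l=1}^d e^{(1)}_{q_{1l}}\otimes\cdots\otimes e^{(d)}_{q_{dl}}\otimes e_l\in\mathbb{R}^{n\times\dots\times n\times d}$ (where $e^{(k)}_q$ denotes the $q$-th standard basis vector in the $k$-th factor), and of core tensors $A^k\in\mathbb{R}^{r_{k-1}\times\tilde p\times n\times r_k}$, $k=1,\dots,d$, such that contracting the cores along consecutive rank indices and contracting their $n$-dimensional indices with $S$ gives the coefficient tensors of all the $f_l$. That is, for every $l$ the coefficient tensor of $f_l$ is $$(\theta_l)_{i_1\dots i_d}=\sum_{l_1,\dots,l_{d-1}}A^1_{1,i_1,q_{1l},l_1}A^2_{l_1,i_2,q_{2l},l_2}\cdots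 A^d_{l_{d-1},i_d,q_{dl},1}.$$ **Single TT representation of a system.** A single TT representation of $[f_1\dots f_d]$ with ranks $(r_1,\dots,r_{d-1})$ ($r_0=1$) consists of cores $A^k\in\mathbb{R}^{r_{k-1}\times\tilde p\times r_k}$ for $k<d$ and a last core $A^d\in\mathbb{R}^{r_{d-1}\times\tilde p\times d}$ carrying the equation index $l$ as an additional index, such that for every $l\in\{1,\dots,d\}$ the coefficient tensor of $f_l$ is $$(\theta_l)_{i_1\dots i_d}=\sum_{l_1,\dots,l_{d-1}}A^1_{1,i_1,l_1}\cdots A^{d-1}_{l_{d-2},i_{d-1},l_{d-1}}A^d_{l_{d-1},i_d,l}.$$ *)

theory Defs
  imports Complex_Main "HOL-Library.Function_Algebras" "HOL-Library.FuncSet"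
begin

text \<open>
  Spaces of real-valued functions are real vector spaces under the pointwise operations, so that
  the library notions \<^term>\<open>span\<close> and \<^term>\<open>independent\<close> apply to sets of functions.
\<close>

instantiation "fun" :: (type, real_vector) real_vector
begin

definition scaleR_fun_def: "c *\<^sub>R f = (\<lambda>x. c *\<^sub>R f x)"

instance
  by standard (auto simp: scaleR_fun_def plus_fun_def scaleR_add_right scaleR_add_left)

end

text \<open>
  The dimension \<open>d\<close> is a natural number and coordinates are numbered from \<open>1\<close> to \<open>d\<close>.
  A function on \<open>d\<close>-dimensional space is encoded as a function of type
  \<^typ>\<open>(nat \<Rightarrow> real) \<Rightarrow> real\<close> that only reads the arguments \<open>x 1, \<dots>, x d\<close>.
  All classes of functions defined below consist of such functions, so that pointwise
  equality on all of \<^typ>\<open>nat \<Rightarrow> real\<close> is equality of functions of \<open>d\<close> real variables.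
\<close>

section \<open>One-dimensional governing equations\<close>

text \<open>
  Tuples \<open>(i\<^sub>l\<^sub>-\<^sub>s\<^sub>1, \<dots>, i\<^sub>l\<^sub>+\<^sub>s\<^sub>2)\<close> are extensional functions on the integer interval of their
  positions; positions outside \<open>1, \<dots>, d\<close> contribute the factor \<open>1\<close>.
\<close>

definition interaction_tuples :: "nat \<Rightarrow> nat \<Rightarrow> nat \<Rightarrow> nat \<Rightarrow> (int \<Rightarrow> nat) set" where
  "interaction_tuples s1 s2 p l = {int l - int s1..int l + int s2} \<rightarrow>\<^sub>E {1..p}"

definition one_dim_governing ::
  "nat \<Rightarrow> nat \<Rightarrow> nat \<Rightarrow> nat \<Rightarrow> nat \<Rightarrow> (nat \<Rightarrow> real \<Rightarrow> real) \<Rightarrow> (nat \<Rightarrow> (nat \<Rightarrow> real) \<Rightarrow> real) \<Rightarrow> bool"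
where
  "one_dim_governing d N s1 s2 p g f \<longleftrightarrow>
    (\<forall>l\<in>{1..d}. \<exists>I \<subseteq> interaction_tuples s1 s2 p l. card I \<le> N \<and>
      (\<forall>x. f l x = (\<Sum>i\<in>I. \<Prod>k\<in>{int l - int s1..int l + int s2}.
                      if 1 \<le> k \<and> k \<le> int d then g (i k) (x (nat k)) else 1)))"

definition leg_space :: "nat \<Rightarrow> (nat \<Rightarrow> real \<Rightarrow> real) \<Rightarrow> (real \<Rightarrow> real) set" where
  "leg_space p g = span (insert (\<lambda>_. 1) (g ` {1..p}))"


section \<open>Tensor powers of a space of univariate functions, coefficient tensors, CP-rank\<close>

definition tensor_power :: "nat \<Rightarrow> (real \<Rightarrow> real) set \<Rightarrow> ((nat \<Rightarrow> real) \<Rightarrow> real) set" where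
  "tensor_power d V = span {(\<lambda>x. \<Prod>k\<in>{1..d}. v k (x k)) | v. \<forall>k\<in>{1..d}. v k \<in> V}"

definition is_basis :: "nat \<Rightarrow> (nat \<Rightarrow> real \<Rightarrow> real) \<Rightarrow> (real \<Rightarrow> real) set \<Rightarrow> bool" where
  "is_basis pt \<psi> V \<longleftrightarrow>
     inj_on \<psi> {1..pt} \<and> independent (\<psi> ` {1..pt}) \<and> span (\<psi> ` {1..pt}) = V"

definition multi_indices :: "nat \<Rightarrow> nat \<Rightarrow> (nat \<Rightarrow> nat) set" where
  "multi_indices d n = {1..d} \<rightarrow>\<^sub>E {1..n}"

definition is_coeff_tensor ::
  "nat \<Rightarrow> nat \<Rightarrow> (nat \<Rightarrow> real \<Rightarrow> real) \<Rightarrow> ((nat \<Rightarrow> real) \<Rightarrow> real) \<Rightarrow> ((nat \<Rightarrow> nat) \<Rightarrow> real) \<Rightarrow> bool"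
where
  "is_coeff_tensor d pt \<psi> f \<theta> \<longleftrightarrow>
     (\<forall>x. f x = (\<Sum>i\<in>multi_indices d pt. \<theta> i * (\<Prod>k\<in>{1..d}. \<psi> (i k) (x k))))"

text \<open>
  The minimum below exists exactly for members of \<^term>\<open>tensor_power d V\<close> (for a subspace \<open>V\<close>
  and \<open>d \<ge> 1\<close>); for other functions the value is meaningless.
\<close>

definition cp_rank :: "nat \<Rightarrow> (real \<Rightarrow> real) set \<Rightarrow> ((nat \<Rightarrow> real) \<Rightarrow> real) \<Rightarrow> nat" where
  "cp_rank d V f = (LEAST r. \<exists>v. (\<forall>j\<in>{1..r}. \<forall>k\<in>{1..d}. v j k \<in> V) \<and>
                      (\<forall>x. f x = (\<Sum>j\<in>{1..r}. \<Prod>k\<in>{1..d}. v j k (x k))))"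


section \<open>Tensor train representations\<close>

text \<open>
  Ranks are positive. Rank indices \<open>\<beta>\<close> range over positions \<open>0, \<dots>, d\<close>; the values at the
  positions \<open>0\<close> and \<open>d\<close> are forced to be \<open>1\<close> by \<open>r 0 = r d = 1\<close>, which leaves exactly the
  summation over the indices at the positions \<open>1, \<dots>, d - 1\<close>.
  The entries of a core are \<open>A k a i b\<close>, with left rank index \<open>a\<close> and right rank index \<open>b\<close>.
\<close>

definition rank_indices :: "nat \<Rightarrow> (nat \<Rightarrow> nat) \<Rightarrow> (nat \<Rightarrow> nat) set" where
  "rank_indices m r = (\<Pi>\<^sub>E k\<in>{0..m}. {1..r k})"

definition tt_contraction ::
  "nat \<Rightarrow> (nat \<Rightarrow> nat) \<Rightarrow> (nat \<Rightarrow> nat \<Rightarrow> nat \<Rightarrow> nat \<Rightarrow> real) \<Rightarrow> (nat \<Rightarrow> nat) \<Rightarrow> real"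
where
  "tt_contraction d r A i = (\<Sum>\<beta>\<in>rank_indices d r. \<Prod>k\<in>{1..d}. A k (\<beta> (k - 1)) (i k) (\<beta> k))"

definition tt_representation ::
  "nat \<Rightarrow> nat \<Rightarrow> (nat \<Rightarrow> real \<Rightarrow> real) \<Rightarrow> ((nat \<Rightarrow> real) \<Rightarrow> real) \<Rightarrow>
   (nat \<Rightarrow> nat) \<Rightarrow> (nat \<Rightarrow> nat \<Rightarrow> nat \<Rightarrow> nat \<Rightarrow> real) \<Rightarrow> bool"
where
  "tt_representation d pt \<psi> f r A \<longleftrightarrow>
     r 0 = 1 \<and> r d = 1 \<and> (\<forall>k\<in>{1..<d}. 1 \<le> r k) \<and>
     is_coeff_tensor d pt \<psi> f (tt_contraction d r A)"


section \<open>Selection tensor representations\<close>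

definition unit_vec :: "nat \<Rightarrow> nat \<Rightarrow> real" where
  "unit_vec j i = (if i = j then 1 else 0)"

text \<open>\<open>Q k l\<close> is the activation type of the \<open>k\<close>-th core in the \<open>l\<close>-th equation.\<close>

definition selection_tensor :: "nat \<Rightarrow> (nat \<Rightarrow> nat \<Rightarrow> nat) \<Rightarrow> (nat \<Rightarrow> nat) \<Rightarrow> nat \<Rightarrow> real" where
  "selection_tensor d Q q l = (\<Sum>m\<in>{1..d}. (\<Prod>k\<in>{1..d}. unit_vec (Q k m) (q k)) * unit_vec m l)"

text \<open>Entries of a core are \<open>A k a i t b\<close>, with the activation index \<open>t\<close> in \<open>1, \<dots>, n\<close>.\<close>

definition selection_contraction ::
  "nat \<Rightarrow> nat \<Rightarrow> (nat \<Rightarrow> nat) \<Rightarrow> (nat \<Rightarrow> nat \<Rightarrow> nat \<Rightarrow> nat \<Rightarrow> nat \<Rightarrow> real) \<Rightarrow>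
   ((nat \<Rightarrow> nat) \<Rightarrow> nat \<Rightarrow> real) \<Rightarrow> nat \<Rightarrow> (nat \<Rightarrow> nat) \<Rightarrow> real"
where
  "selection_contraction d n r A S l i =
     (\<Sum>q\<in>multi_indices d n. S q l *
        (\<Sum>\<beta>\<in>rank_indices d r. \<Prod>k\<in>{1..d}. A k (\<beta> (k - 1)) (i k) (q k) (\<beta> k)))"

definition selection_representation ::
  "nat \<Rightarrow> nat \<Rightarrow> (nat \<Rightarrow> real \<Rightarrow> real) \<Rightarrow> (nat \<Rightarrow> (nat \<Rightarrow> real) \<Rightarrow> real) \<Rightarrow>
   nat \<Rightarrow> (nat \<Rightarrow> nat \<Rightarrow> nat) \<Rightarrow> (nat \<Rightarrow> nat) \<Rightarrow> (nat \<Rightarrow> nat \<Rightarrow> nat \<Rightarrow> nat \<Rightarrow> nat \<Rightarrow> real) \<Rightarrow> bool"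
where
  "selection_representation d pt \<psi> f n Q r A \<longleftrightarrow>
     (\<forall>k\<in>{1..d}. \<forall>l\<in>{1..d}. Q k l \<in> {1..n}) \<and>
     r 0 = 1 \<and> r d = 1 \<and> (\<forall>k\<in>{1..<d}. 1 \<le> r k) \<and>
     (\<forall>l\<in>{1..d}. is_coeff_tensor d pt \<psi> (f l)
        (selection_contraction d n r A (selection_tensor d Q) l))"

lemma selection_tensor_eq:
  assumes "l \<in> {1..d}"
  shows "selection_tensor d Q q l = (if \<forall>k\<in>{1..d}. q k = Q k l then 1 else 0)"
proof -
  have "selection_tensor d Q q l =
      (\<Sum>m\<in>{1..d}. if m = l then \<Prod>k\<in>{1..d}. unit_vec (Q k l) (q k) else 0)"
    unfolding selection_tensor_def by (rule sum.cong) (auto simp: unit_vec_def)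
  also have "\<dots> = (\<Prod>k\<in>{1..d}. unit_vec (Q k l) (q k))"
    using assms by simp
  also have "\<dots> = (if \<forall>k\<in>{1..d}. q k = Q k l then 1 else 0)"
  proof (cases "\<forall>k\<in>{1..d}. q k = Q k l")
    case False
    then show ?thesis by (auto simp: unit_vec_def intro!: prod_zero)
  qed (simp add: unit_vec_def)
  finally show ?thesis .
qed

lemma selection_contraction_eq:
  assumes "\<forall>k\<in>{1..d}. Q k l \<in> {1..n}" and "l \<in> {1..d}"
  shows "selection_contraction d n r A (selection_tensor d Q) l i =
    (\<Sum>\<beta>\<in>rank_indices d r. \<Prod>k\<in>{1..d}. A k (\<beta> (k - 1)) (i k) (Q k l) (\<beta> k))"
proof -
  define q0 where "q0 = restrict (\<lambda>k. Q k l) {1..d}"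
  let ?T = "\<lambda>q. \<Sum>\<beta>\<in>rank_indices d r. \<Prod>k\<in>{1..d}. A k (\<beta> (k - 1)) (i k) (q k) (\<beta> k)"
  have q0: "q0 \<in> multi_indices d n"
    using assms(1) by (auto simp: q0_def multi_indices_def)
  have fin: "finite (multi_indices d n)"
    by (simp add: multi_indices_def finite_PiE)
  have "selection_contraction d n r A (selection_tensor d Q) l i =
      (\<Sum>q\<in>multi_indices d n. if q = q0 then ?T q0 else 0)"
    unfolding selection_contraction_def
  proof (rule sum.cong)
    fix q assume "q \<in> multi_indices d n"
    then have "(\<forall>k\<in>{1..d}. q k = Q k l) \<longleftrightarrow> q = q0"
      by (auto simp: q0_def multi_indices_def PiE_def extensional_def fun_eq_iff)
    then show "selection_tensor d Q q l * ?T q = (if q = q0 then ?T q0 else 0)"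
      using selection_tensor_eq[OF assms(2), of Q q] by auto
  qed simp
  also have "\<dots> = ?T q0"
    using q0 fin by simp
  also have "\<dots> = ?T (\<lambda>k. Q k l)"
    by (intro sum.cong prod.cong) (auto simp: q0_def)
  finally show ?thesis .
qed


section \<open>Single tensor train representations of a system\<close>

text \<open>The right index of the last core is the equation index \<open>l\<close>; only \<open>r 0, \<dots>, r (d - 1)\<close> matter.\<close>

definition system_tt_contraction ::
  "nat \<Rightarrow> (nat \<Rightarrow> nat) \<Rightarrow> (nat \<Rightarrow> nat \<Rightarrow> nat \<Rightarrow> nat \<Rightarrow> real) \<Rightarrow> nat \<Rightarrow> (nat \<Rightarrow> nat) \<Rightarrow> real"
where
  "system_tt_contraction d r A l i =
     (\<Sum>\<beta>\<in>rank_indices (d - 1) r.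
        (\<Prod>k\<in>{1..<d}. A k (\<beta> (k - 1)) (i k) (\<beta> k)) * A d (\<beta> (d - 1)) (i d) l)"

definition single_tt_representation ::
  "nat \<Rightarrow> nat \<Rightarrow> (nat \<Rightarrow> real \<Rightarrow> real) \<Rightarrow> (nat \<Rightarrow> (nat \<Rightarrow> real) \<Rightarrow> real) \<Rightarrow>
   (nat \<Rightarrow> nat) \<Rightarrow> (nat \<Rightarrow> nat \<Rightarrow> nat \<Rightarrow> nat \<Rightarrow> real) \<Rightarrow> bool"
where
  "single_tt_representation d pt \<psi> f r A \<longleftrightarrow>
     r 0 = 1 \<and> (\<forall>k\<in>{1..<d}. 1 \<le> r k) \<and>
     (\<forall>l\<in>{1..d}. is_coeff_tensor d pt \<psi> (f l) (system_tt_contraction d r A l))"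

end

theory Submission
  imports Defs
begin

text \<open>
  By the interaction range, equation \<open>l\<close> is a sum of at most \<open>N\<close> products in which every factor at
  a position outside \<open>l - s1, \<dots>, l + s2\<close> is the constant \<open>1\<close>. Padding with products that vanish
  at position \<open>l\<close> makes the number of terms exactly \<open>N\<close> without destroying this
  (\<open>ex_local_cp_decomposition\<close>). This is already the CP decomposition.

  For tensor trains, cut the coordinates into \<open>x\<^sub>1, \<dots>, x\<^sub>k\<close> and the rest. The partial contraction of
  the first \<open>k\<close> cores gives \<open>r k\<close> functions of \<open>x\<^sub>1, \<dots>, x\<^sub>k\<close>, the left interface functions, and core
  \<open>k + 1\<close> says how the interface functions at cut \<open>k + 1\<close> are linear combinations of those at
  cut \<open>k\<close> with coefficients in \<open>V\<close>, evaluated at \<open>x\<^sub>k\<^sub>+\<^sub>1\<close>. Conversely, any finite sets \<open>W k\<close> of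
  functions with \<open>W 0 = {1}\<close> in which each set is obtained from the preceding one by such
  combinations, and the equations are so obtained from the last one, yield a single tensor train
  representation with ranks \<open>card (W k)\<close> (\<open>single_tt_representation_of_interfaces\<close>). So the ranks
  can be read off from a choice of interface functions.

  For a single equation \<open>l\<close> the interface is \<open>{1}\<close> before the interaction range is reached, the \<open>N\<close>
  products truncated after position \<open>k\<close> while the cut \<open>k\<close> lies inside the range, and \<open>{f l}\<close>
  once all interacting coordinates have been read; hence ranks \<open>1\<close>, at most \<open>N\<close>, and \<open>1\<close>. For the
  whole system take the union over \<open>l\<close> of these interfaces. The function \<open>1\<close> is shared by all
  equations that have not started, the \<open>max 0 (k - s2)\<close> finished equations contribute one function
  each, and the cut \<open>k\<close> lies inside the range of the equations with \<open>k - s2 < l \<le> k + s1\<close>, each of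
  which contributes at most \<open>N\<close>. When \<open>k \<ge> s2\<close> this adds up to the asserted bound. When \<open>k < s2\<close> at
  most \<open>k + s1\<close> equations are open, and the saving \<open>N (s2 - k)\<close> is at least the \<open>s2 - k\<close> by which
  the asserted bound drops, because \<open>N \<ge> 1\<close>.

  For the selection tensor format the \<open>N\<close> products are propagated diagonally with rank \<open>N\<close> at every
  cut. A core then has to know only its position relative to \<open>l\<close>: there are \<open>s1 + s2 + 1\<close> relative
  positions in the range, and a single further type for all positions outside, where every factor
  is \<open>1\<close>.
\<close>

section \<open>Coefficient tensors of tensor trains\<close>

lemma is_coeff_tensor_sum:
  assumes "\<And>\<beta>. \<beta> \<in> B \<Longrightarrow> is_coeff_tensor d pt \<psi> (h \<beta>) (\<theta> \<beta>)"
  shows "is_coeff_tensor d pt \<psi> (\<lambda>x. \<Sum>\<beta>\<in>B. h \<beta> x) (\<lambda>i. \<Sum>\<beta>\<in>B. \<theta> \<beta> i)"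
  unfolding is_coeff_tensor_def
proof
  fix x
  have "(\<Sum>\<beta>\<in>B. h \<beta> x) =
      (\<Sum>\<beta>\<in>B. \<Sum>i\<in>multi_indices d pt. \<theta> \<beta> i * (\<Prod>k\<in>{1..d}. \<psi> (i k) (x k)))"
    using assms by (intro sum.cong) (auto simp: is_coeff_tensor_def)
  also have "\<dots> = (\<Sum>i\<in>multi_indices d pt. \<Sum>\<beta>\<in>B. \<theta> \<beta> i * (\<Prod>k\<in>{1..d}. \<psi> (i k) (x k)))"
    by (rule sum.swap)
  finally show "(\<Sum>\<beta>\<in>B. h \<beta> x) =
      (\<Sum>i\<in>multi_indices d pt. (\<Sum>\<beta>\<in>B. \<theta> \<beta> i) * (\<Prod>k\<in>{1..d}. \<psi> (i k) (x k)))"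
    by (simp add: sum_distrib_right)
qed

lemma is_coeff_tensor_prod:
  "is_coeff_tensor d pt \<psi> (\<lambda>x. \<Prod>k\<in>{1..d}. \<Sum>i\<in>{1..pt}. c k i * \<psi> i (x k))
     (\<lambda>i. \<Prod>k\<in>{1..d}. c k (i k))"
  unfolding is_coeff_tensor_def multi_indices_def
  by (simp add: prod_sum_PiE prod.distrib)

text \<open>
  Splitting off the rank index at the last cut; the remaining indices have to be restricted because
  rank index tuples are extensional.
\<close>

lemma sum_rank_indices_Suc:
  "(\<Sum>\<beta>\<in>rank_indices (Suc m) r. F (restrict \<beta> {0..m}) (\<beta> (Suc m))) =
   (\<Sum>b\<in>{1..r (Suc m)}. \<Sum>\<beta>\<in>rank_indices m r. F \<beta> b)"
proof -
  have ins: "{0..Suc m} = insert (Suc m) {0..m}" by auto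
  have "(\<Sum>\<beta>\<in>rank_indices (Suc m) r. F (restrict \<beta> {0..m}) (\<beta> (Suc m))) =
      (\<Sum>(b, \<beta>)\<in>{1..r (Suc m)} \<times> rank_indices m r. F \<beta> b)"
  proof (rule sum.reindex_bij_witness[where
        i = "\<lambda>(b, \<beta>). \<beta>(Suc m := b)" and j = "\<lambda>\<beta>. (\<beta> (Suc m), restrict \<beta> {0..m})"], goal_cases)
    case (1 a)
    then show ?case
      by (auto simp: rank_indices_def PiE_def extensional_def fun_eq_iff restrict_def)
  next
    case (2 a)
    then show ?case by (auto simp: rank_indices_def)
  next
    case (3 b)
    then show ?case
      by (auto simp: rank_indices_def PiE_def extensional_def fun_eq_iff restrict_def)
  next
    case (4 b)
    then show ?case
      unfolding rank_indices_def ins by (auto simp: PiE_insert_eq)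
  next
    case (5 a)
    then show ?case by simp
  qed
  then show ?thesis by (simp add: sum.cartesian_product)
qed

text \<open>
  Contracting a chain of cores amounts to multiplying the row vector \<open>U k\<close> by one matrix after the
  other. The weight \<open>w\<close> on the last rank index stands for all later cores and makes the induction
  go through.
\<close>

lemma contraction_eq_interface:
  fixes G :: "nat \<Rightarrow> nat \<Rightarrow> nat \<Rightarrow> real" and U :: "nat \<Rightarrow> nat \<Rightarrow> real"
  assumes "r 0 = 1" "U 0 1 = 1"
    and "\<And>k b. k < d \<Longrightarrow> b \<in> {1..r (Suc k)} \<Longrightarrow>
           U (Suc k) b = (\<Sum>a\<in>{1..r k}. U k a * G (Suc k) a b)"
  shows "(\<Sum>\<beta>\<in>rank_indices d r. (\<Prod>k\<in>{1..d}. G k (\<beta> (k - 1)) (\<beta> k)) * w (\<beta> d)) =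
         (\<Sum>b\<in>{1..r d}. U d b * w b)"
  using assms(3)
proof (induction d arbitrary: w)
  case 0
  have "rank_indices 0 r = {\<lambda>k\<in>{0}. 1}"
    unfolding rank_indices_def using \<open>r 0 = 1\<close>
    by (auto simp: PiE_def extensional_def fun_eq_iff Pi_def restrict_def)
  then show ?case using assms(1,2) by simp
next
  case (Suc d)
  let ?P = "\<lambda>\<beta>. \<Prod>k\<in>{1..d}. G k (\<beta> (k - 1)) (\<beta> k)"
  have "(\<Sum>\<beta>\<in>rank_indices (Suc d) r. (\<Prod>k\<in>{1..Suc d}. G k (\<beta> (k - 1)) (\<beta> k)) * w (\<beta> (Suc d)))
      = (\<Sum>\<beta>\<in>rank_indices (Suc d) r. ?P (restrict \<beta> {0..d}) *
           (G (Suc d) (restrict \<beta> {0..d} d) (\<beta> (Suc d)) * w (\<beta> (Suc d))))"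
    by (intro sum.cong refl) (simp add: mult.assoc, intro disjI2 prod.cong, auto)
  also have "\<dots> = (\<Sum>b\<in>{1..r (Suc d)}. \<Sum>\<beta>\<in>rank_indices d r. ?P \<beta> * (G (Suc d) (\<beta> d) b * w b))"
    by (rule sum_rank_indices_Suc[where F = "\<lambda>\<beta> b. ?P \<beta> * (G (Suc d) (\<beta> d) b * w b)"])
  also have "\<dots> = (\<Sum>b\<in>{1..r (Suc d)}. \<Sum>a\<in>{1..r d}. U d a * (G (Suc d) a b * w b))"
    using Suc.prems by (intro sum.cong refl Suc.IH) auto
  also have "\<dots> = (\<Sum>b\<in>{1..r (Suc d)}. U (Suc d) b * w b)"
    using Suc.prems by (intro sum.cong refl) (simp add: sum_distrib_right mult.assoc)
  finally show ?case .
qed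

text \<open>
  Contracting cores of coefficients and then inserting the basis functions is the same as
  contracting cores of univariate functions, so that a tensor train representation can be verified
  by exhibiting its left interface functions \<open>U k b\<close>.
\<close>

lemma is_coeff_tensor_tt_contraction:
  fixes U :: "nat \<Rightarrow> nat \<Rightarrow> (nat \<Rightarrow> real) \<Rightarrow> real"
  assumes "r 0 = 1" "r d = 1" "\<And>x. U 0 1 x = 1" "\<And>x. U d 1 x = f x"
    and "\<And>k b x. k < d \<Longrightarrow> b \<in> {1..r (Suc k)} \<Longrightarrow> U (Suc k) b x =
      (\<Sum>a\<in>{1..r k}. U k a x * (\<Sum>i\<in>{1..pt}. A (Suc k) a i b * \<psi> i (x (Suc k))))"
  shows "is_coeff_tensor d pt \<psi> f (tt_contraction d r A)"
proof -
  let ?G = "\<lambda>x k a b. \<Sum>i\<in>{1..pt}. A k a i b * \<psi> i (x k)"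
  have "is_coeff_tensor d pt \<psi>
      (\<lambda>x. \<Sum>\<beta>\<in>rank_indices d r. \<Prod>k\<in>{1..d}. ?G x k (\<beta> (k - 1)) (\<beta> k)) (tt_contraction d r A)"
    unfolding tt_contraction_def by (intro is_coeff_tensor_sum is_coeff_tensor_prod)
  moreover have "(\<Sum>\<beta>\<in>rank_indices d r. \<Prod>k\<in>{1..d}. ?G x k (\<beta> (k - 1)) (\<beta> k)) = f x" for x
    using contraction_eq_interface[where G = "?G x" and U = "\<lambda>k b. U k b x" and w = "\<lambda>_. 1"
        and r = r and d = d] assms by simp
  ultimately show ?thesis by simp
qed

text \<open>
  Fixing the equation index turns the system contraction into an ordinary one, so that both formats
  are covered by the preceding criterion.
\<close>

lemma system_tt_contraction_eq:
  assumes "d \<ge> 1"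
  shows "system_tt_contraction d r A l =
    tt_contraction d (r(d := 1)) (A(d := \<lambda>a i b. A d a i l))"
proof
  fix i
  obtain m where d: "d = Suc m" using assms by (cases d) auto
  let ?T = "\<lambda>\<beta>. (\<Prod>k\<in>{1..m}. A k (\<beta> (k - 1)) (i k) (\<beta> k)) * A d (\<beta> m) (i d) l"
  have "rank_indices m (r(d := 1)) = rank_indices m r"
    unfolding rank_indices_def d by (intro PiE_cong) auto
  then have "system_tt_contraction d r A l i =
      (\<Sum>b\<in>{1..(r(d := 1)) (Suc m)}. \<Sum>\<beta>\<in>rank_indices m (r(d := 1)). ?T \<beta>)"
    by (simp add: system_tt_contraction_def d atLeastLessThanSuc_atLeastAtMost)
  also have "\<dots> = (\<Sum>\<beta>\<in>rank_indices d (r(d := 1)). ?T (restrict \<beta> {0..m}))"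
    unfolding d by (rule sum_rank_indices_Suc[symmetric])
  also have "\<dots> = tt_contraction d (r(d := 1)) (A(d := \<lambda>a i b. A d a i l)) i"
    unfolding tt_contraction_def d prod.atLeast1_atMost_eq
    by (intro sum.cong refl) (simp, intro disjI2 prod.cong, auto)
  finally show "system_tt_contraction d r A l i = \<dots>" .
qed

lemma tt_representation_of_single_tt_representation:
  assumes "d \<ge> 1" "single_tt_representation d pt \<psi> f r A" "l \<in> {1..d}"
  shows "tt_representation d pt \<psi> (f l) (r(d := 1)) (A(d := \<lambda>a i b. A d a i l))"
proof -
  have "is_coeff_tensor d pt \<psi> (f l) (system_tt_contraction d r A l)"
    using assms(2,3) by (simp add: single_tt_representation_def)
  then show ?thesis
    using assms system_tt_contraction_eq[OF assms(1), of r A l]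
    by (simp add: single_tt_representation_def tt_representation_def)
qed

lemma is_basis_coordinates:
  assumes "is_basis pt \<psi> V"
  obtains C where "\<And>c y. c \<in> V \<Longrightarrow> c y = (\<Sum>i\<in>{1..pt}. C c i * \<psi> i y)"
proof -
  have "\<exists>a. \<forall>y. c y = (\<Sum>i\<in>{1..pt}. a i * \<psi> i y)" if "c \<in> V" for c
  proof -
    have inj: "inj_on \<psi> {1..pt}" and "c \<in> span (\<psi> ` {1..pt})"
      using assms that by (auto simp: is_basis_def)
    then obtain u where "c = (\<Sum>w\<in>\<psi> ` {1..pt}. u w *\<^sub>R w)"
      by (auto simp: span_finite)
    then have "c = (\<Sum>i\<in>{1..pt}. u (\<psi> i) *\<^sub>R \<psi> i)"
      using sum.reindex[OF inj, of "\<lambda>w. u w *\<^sub>R w"] by (simp add: o_def)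
    moreover have "(\<Sum>i\<in>S. u (\<psi> i) *\<^sub>R \<psi> i) y = (\<Sum>i\<in>S. u (\<psi> i) * \<psi> i y)" if "finite S" for y S
      using that by induction (auto simp: scaleR_fun_def)
    ultimately show ?thesis by (intro exI[of _ "\<lambda>i. u (\<psi> i)"]) auto
  qed
  then show ?thesis using that by metis
qed


section \<open>Interface sets\<close>

text \<open>
  The univariate coefficients depend on the coordinate \<open>k + 1\<close>: cut \<open>k\<close> lies between the positions
  \<open>k\<close> and \<open>k + 1\<close>.
\<close>

definition extends :: "(real \<Rightarrow> real) set \<Rightarrow> nat \<Rightarrow> ((nat \<Rightarrow> real) \<Rightarrow> real) set \<Rightarrow>
    ((nat \<Rightarrow> real) \<Rightarrow> real) \<Rightarrow> bool" where
  "extends V k W u \<longleftrightarrow>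
    (\<exists>c. (\<forall>w\<in>W. c w \<in> V) \<and> (\<forall>x. u x = (\<Sum>w\<in>W. w x * c w (x (Suc k)))))"

lemma extends_mult:
  assumes "subspace V" "finite W" "w \<in> W" "c \<in> V"
  shows "extends V k W (\<lambda>x. w x * c (x (Suc k)))"
  unfolding extends_def
proof (intro exI[of _ "\<lambda>w'. if w' = w then c else 0"] conjI ballI allI)
  fix x
  have "(\<Sum>w'\<in>W. w' x * (if w' = w then c else 0) (x (Suc k))) =
      (\<Sum>w'\<in>W. if w' = w then w x * c (x (Suc k)) else 0)"
    by (intro sum.cong) auto
  then show "w x * c (x (Suc k)) = (\<Sum>w'\<in>W. w' x * (if w' = w then c else 0) (x (Suc k)))"
    using assms by simp
qed (use assms in \<open>auto simp: subspace_0\<close>)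

lemma extends_sum:
  assumes "subspace V" "\<And>j. j \<in> J \<Longrightarrow> extends V k W (u j)"
  shows "extends V k W (\<lambda>x. \<Sum>j\<in>J. u j x)"
proof -
  have "\<forall>j\<in>J. \<exists>c. (\<forall>w\<in>W. c w \<in> V) \<and> (\<forall>x. u j x = (\<Sum>w\<in>W. w x * c w (x (Suc k))))"
    using assms(2) by (simp only: extends_def) blast
  from bchoice[OF this] obtain c where c: "\<forall>j\<in>J. (\<forall>w\<in>W. c j w \<in> V) \<and>
      (\<forall>x. u j x = (\<Sum>w\<in>W. w x * c j w (x (Suc k))))"
    by blast
  have app: "(\<Sum>j\<in>J. c j w) y = (\<Sum>j\<in>J. c j w y)" for w y
    by (induction J rule: infinite_finite_induct) auto
  show ?thesis
    unfolding extends_def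
  proof (intro exI[of _ "\<lambda>w. \<Sum>j\<in>J. c j w"] conjI ballI allI)
    show "(\<Sum>j\<in>J. c j w) \<in> V" if "w \<in> W" for w
      using c that assms(1) by (intro subspace_sum) auto
    show "(\<Sum>j\<in>J. u j x) = (\<Sum>w\<in>W. w x * (\<Sum>j\<in>J. c j w) (x (Suc k)))" for x
      unfolding app sum_distrib_left by (subst sum.swap) (simp add: c)
  qed
qed

lemma extends_mono:
  assumes "subspace V" "extends V k W u" "W \<subseteq> W'" "finite W'"
  shows "extends V k W' u"
proof -
  from assms(2) obtain c where c: "\<forall>w\<in>W. c w \<in> V" "\<forall>x. u x = (\<Sum>w\<in>W. w x * c w (x (Suc k)))"
    unfolding extends_def by blast
  have "u = (\<lambda>x. \<Sum>w\<in>W. w x * c w (x (Suc k)))"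
    using c(2) by blast
  moreover have "extends V k W' (\<lambda>x. \<Sum>w\<in>W. w x * c w (x (Suc k)))"
    using c(1) assms by (intro extends_sum extends_mult) auto
  ultimately show ?thesis by simp
qed

text \<open>
  Enumerating each \<open>W k\<close> by its rank indices and expanding the coefficients of the combinations in
  the basis gives the cores. Since the ranks are cardinalities of sets of functions, functions that
  coincide are automatically counted only once.
\<close>

lemma single_tt_representation_of_interfaces:
  assumes d: "d \<ge> 1" and basis: "is_basis pt \<psi> V"
    and W0: "W 0 = {\<lambda>_. 1}"
    and fin: "\<And>k. k < d \<Longrightarrow> finite (W k) \<and> W k \<noteq> {}"
    and step: "\<And>k u. Suc k < d \<Longrightarrow> u \<in> W (Suc k) \<Longrightarrow> extends V k (W k) u"
    and last: "\<And>l. l \<in> {1..d} \<Longrightarrow> extends V (d - 1) (W (d - 1)) (f l)"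
  obtains A where "single_tt_representation d pt \<psi> f (\<lambda>k. card (W k)) A"
proof -
  obtain C where C: "\<And>c y. c \<in> V \<Longrightarrow> c y = (\<Sum>i\<in>{1..pt}. C c i * \<psi> i y)"
    using is_basis_coordinates[OF basis] by blast
  define e where "e k = (SOME h. bij_betw h {1..card (W k)} (W k))" for k
  have e: "bij_betw (e k) {1..card (W k)} (W k)" if "k < d" for k
    unfolding e_def using fin[OF that] by (intro someI_ex[OF ex_bij_betw_nat_finite_1]) auto
  define c where "c k u = (SOME c. (\<forall>w\<in>W k. c w \<in> V) \<and>
      (\<forall>x. u x = (\<Sum>w\<in>W k. w x * c w (x (Suc k)))))" for k u
  have c: "(\<forall>w\<in>W k. c k u w \<in> V) \<and> (\<forall>x. u x = (\<Sum>w\<in>W k. w x * c k u w (x (Suc k))))"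
    if "extends V k (W k) u" for k u
    using that unfolding extends_def c_def by (rule someI_ex)
  have expand: "u x = (\<Sum>a\<in>{1..card (W k)}. e k a x *
      (\<Sum>i\<in>{1..pt}. C (c k u (e k a)) i * \<psi> i (x (Suc k))))"
    if "k < d" "extends V k (W k) u" for k u x
  proof -
    have "u x = (\<Sum>w\<in>W k. w x * c k u w (x (Suc k)))"
      using c[OF that(2)] by blast
    also have "\<dots> = (\<Sum>w\<in>W k. w x * (\<Sum>i\<in>{1..pt}. C (c k u w) i * \<psi> i (x (Suc k))))"
      using c[OF that(2)] C by (intro sum.cong refl arg_cong2[where f = "(*)"]) blast
    also have "\<dots> = (\<Sum>a\<in>{1..card (W k)}. e k a x *
      (\<Sum>i\<in>{1..pt}. C (c k u (e k a)) i * \<psi> i (x (Suc k))))"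
      by (rule sum.reindex_bij_betw[OF e[OF that(1)], symmetric])
    finally show ?thesis .
  qed
  \<comment> \<open>The right index of the last core is an equation index rather than a rank index.\<close>
  define A where "A k a i b =
      C (c (k - 1) (if k = d then f b else e k b) (e (k - 1) a)) i" for k a i b
  let ?r = "\<lambda>k. card (W k)"
  have "is_coeff_tensor d pt \<psi> (f l) (system_tt_contraction d ?r A l)" if l: "l \<in> {1..d}" for l
    unfolding system_tt_contraction_eq[OF d]
  proof (rule is_coeff_tensor_tt_contraction[where U = "\<lambda>k b. if k = d then f l else e k b"])
    show "(?r(d := 1)) 0 = 1" "(?r(d := 1)) d = 1"
      using d W0 by auto
    have "bij_betw (e 0) {1} {\<lambda>_. 1::real}"
      using e[of 0] d W0 by simp
    then show "(if 0 = d then f l else e 0 1) x = 1" for x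
      using d by (simp add: bij_betw_def)
    show "(if Suc k = d then f l else e (Suc k) b) x = (\<Sum>a\<in>{1..(?r(d := 1)) k}.
        (if k = d then f l else e k a) x *
        (\<Sum>i\<in>{1..pt}. (A(d := \<lambda>a i b. A d a i l)) (Suc k) a i b * \<psi> i (x (Suc k))))"
      if k: "k < d" and b: "b \<in> {1..(?r(d := 1)) (Suc k)}" for k b x
    proof (cases "Suc k = d")
      case True
      then show ?thesis
        using expand[OF k, of "f l" x] last[OF l] k by (auto simp: A_def)
    next
      case False
      then have "Suc k < d" using k by simp
      moreover have "e (Suc k) b \<in> W (Suc k)"
        using b False e[OF \<open>Suc k < d\<close>] by (auto simp: bij_betw_def)
      ultimately show ?thesis
        using expand[OF k step, of "e (Suc k) b" x] False k by (auto simp: A_def)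
    qed
  qed simp
  then have "single_tt_representation d pt \<psi> f ?r A"
    using W0 fin by (auto simp: single_tt_representation_def Suc_le_eq card_gt_0_iff)
  then show ?thesis by (rule that)
qed


section \<open>Sums of products of univariate functions\<close>

definition leading_prod :: "(nat \<Rightarrow> real \<Rightarrow> real) \<Rightarrow> nat \<Rightarrow> (nat \<Rightarrow> real) \<Rightarrow> real" where
  "leading_prod v m x = (\<Prod>k\<in>{1..m}. v k (x k))"

lemma leading_prod_0 [simp]: "leading_prod v 0 x = 1"
  by (simp add: leading_prod_def)

lemma leading_prod_Suc: "leading_prod v (Suc m) x = leading_prod v m x * v (Suc m) (x (Suc m))"
  by (simp add: leading_prod_def)

lemma leading_prod_eqI:
  assumes "m \<le> n" "\<And>k. m < k \<Longrightarrow> k \<le> n \<Longrightarrow> v k = (\<lambda>_. 1)"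
  shows "leading_prod v n x = leading_prod v m x"
  unfolding leading_prod_def using assms by (intro prod.mono_neutral_right) auto

lemma leading_prod_eq_1:
  assumes "\<And>k. 1 \<le> k \<Longrightarrow> k \<le> m \<Longrightarrow> v k = (\<lambda>_. 1)"
  shows "leading_prod v m x = 1"
  using leading_prod_eqI[of 0 m v x] assms by simp

lemma leading_prod_in_tensor_power:
  assumes "\<And>k. k \<in> {1..d} \<Longrightarrow> v k \<in> V"
  shows "leading_prod v d \<in> tensor_power d V"
  unfolding tensor_power_def using assms
  by (intro span_base CollectI exI[of _ v]) (auto simp: leading_prod_def)

text \<open>
  All that the representations need to know about a single equation: exactly \<open>N\<close> products, with
  factor \<open>1\<close> outside the interaction range of position \<open>l\<close>.
\<close>

locale local_cp_decomposition =
  fixes d N s1 s2 l :: nat and V :: "(real \<Rightarrow> real) set"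
    and f :: "(nat \<Rightarrow> real) \<Rightarrow> real" and v :: "nat \<Rightarrow> nat \<Rightarrow> real \<Rightarrow> real"
  assumes N_pos: "N \<ge> 1" and l_range: "l \<in> {1..d}"
    and V_subspace: "subspace V" and const_in_V: "(\<lambda>_. 1) \<in> V"
    and v_in_V: "v j k \<in> V"
    and v_outside: "k + s1 < l \<or> l + s2 < k \<Longrightarrow> v j k = (\<lambda>_. 1)"
    and decomposition: "f x = (\<Sum>j\<in>{1..N}. leading_prod (v j) d x)"

lemma ex_local_cp_decomposition:
  assumes "N \<ge> 1" and gov: "one_dim_governing d N s1 s2 p g f" and l: "l \<in> {1..d}"
  shows "\<exists>v. local_cp_decomposition d N s1 s2 l (leg_space p g) (f l) v"
proof -
  let ?J = "{int l - int s1..int l + int s2}"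
  obtain I where I: "I \<subseteq> interaction_tuples s1 s2 p l" "card I \<le> N"
    and f: "\<And>x. f l x = (\<Sum>i\<in>I. \<Prod>k\<in>?J. if 1 \<le> k \<and> k \<le> int d then g (i k) (x (nat k)) else 1)"
    using gov l unfolding one_dim_governing_def by meson
  have "finite I"
    using I(1) by (rule finite_subset) (simp add: interaction_tuples_def finite_PiE)
  then obtain h where h: "bij_betw h {1..card I} I"
    using ex_bij_betw_nat_finite_1 by blast
  define V where "V = leg_space p g"
  have subV: "subspace V" and oneV: "(\<lambda>_. 1) \<in> V" and gV: "\<And>i. i \<in> {1..p} \<Longrightarrow> g i \<in> V"
    unfolding V_def leg_space_def by (auto intro: span_base)
  \<comment> \<open>Terms beyond \<open>card I\<close> vanish because of the factor \<open>0\<close> at position \<open>l\<close>, which always belongs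
    to the interaction range.\<close>
  define v where "v j k =
      (if card I < j then (if k = l then (\<lambda>_. 0) else (\<lambda>_. 1))
       else if k + s1 < l \<or> l + s2 < k \<or> j = 0 then (\<lambda>_. 1) else g (h j (int k)))" for j k
  have zeroV: "(\<lambda>_. 0) \<in> V"
    using subspace_0[OF subV] by (simp add: zero_fun_def)
  have "v j k \<in> V" for j k
  proof -
    have "h j (int k) \<in> {1..p}" if "\<not> card I < j" "j \<noteq> 0" "\<not> (k + s1 < l \<or> l + s2 < k)"
    proof -
      have "h j \<in> interaction_tuples s1 s2 p l"
        using that h I(1) by (auto simp: bij_betw_def)
      then show ?thesis
        unfolding interaction_tuples_def by (rule PiE_mem) (use that in auto)
    qed
    then show ?thesis
      using oneV zeroV gV by (auto simp: v_def)
  qed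
  moreover have "v j k = (\<lambda>_. 1)" if "k + s1 < l \<or> l + s2 < k" for j k
    using that by (auto simp: v_def)
  moreover have "f l x = (\<Sum>j\<in>{1..N}. leading_prod (v j) d x)" for x
  proof -
    have prod_eq: "(\<Prod>k\<in>?J. if 1 \<le> k \<and> k \<le> int d then g (h j k) (x (nat k)) else 1) =
        leading_prod (v j) d x" if j: "j \<in> {1..card I}" for j
    proof -
      have "(\<Prod>k\<in>?J. if 1 \<le> k \<and> k \<le> int d then g (h j k) (x (nat k)) else 1) =
          (\<Prod>k\<in>?J \<inter> {1..int d}. g (h j k) (x (nat k)))"
        by (subst prod.inter_restrict) auto
      also have "\<dots> = (\<Prod>k\<in>{1..int d}. if k \<in> ?J then g (h j k) (x (nat k)) else 1)"
        by (subst Int_commute, subst prod.inter_restrict) auto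
      also have "\<dots> = (\<Prod>k\<in>{1..d}. if int k \<in> ?J then g (h j (int k)) (x k) else 1)"
        by (rule prod.reindex_bij_witness[where i = int and j = nat]) auto
      also have "\<dots> = leading_prod (v j) d x"
        unfolding leading_prod_def using j by (intro prod.cong) (auto simp: v_def)
      finally show ?thesis .
    qed
    have "f l x = (\<Sum>j\<in>{1..card I}. leading_prod (v j) d x)"
      unfolding f sum.reindex_bij_betw[OF h, symmetric] using prod_eq by (intro sum.cong) auto
    also have "\<dots> = (\<Sum>j\<in>{1..N}. leading_prod (v j) d x)"
    proof (rule sum.mono_neutral_left)
      show "\<forall>j\<in>{1..N} - {1..card I}. leading_prod (v j) d x = 0"
        using l unfolding leading_prod_def by (intro ballI prod_zero) (auto simp: v_def intro!: bexI[of _ l])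
    qed (use I(2) in auto)
    finally show ?thesis .
  qed
  ultimately show ?thesis
    using assms(1) l subV oneV unfolding V_def
    by (intro exI[of _ v]) (simp add: local_cp_decomposition_def)
qed

context local_cp_decomposition
begin

lemma in_tensor_power: "f \<in> tensor_power d V"
proof -
  have "(\<Sum>j\<in>J. leading_prod (v j) d) x = (\<Sum>j\<in>J. leading_prod (v j) d x)" for x and J :: "nat set"
    by (induction J rule: infinite_finite_induct) auto
  then have "f = (\<Sum>j\<in>{1..N}. leading_prod (v j) d)"
    using decomposition by auto
  moreover have "subspace (tensor_power d V)"
    by (simp add: tensor_power_def)
  ultimately show ?thesis
    using leading_prod_in_tensor_power v_in_V by (metis (no_types, lifting) subspace_sum)
qed

lemma cp_rank_le: "cp_rank d V f \<le> N"
  unfolding cp_rank_def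
proof (rule Least_le, intro exI[of _ v] conjI)
  show "\<forall>x. f x = (\<Sum>j\<in>{1..N}. \<Prod>k\<in>{1..d}. v j k (x k))"
    using decomposition by (simp add: leading_prod_def)
qed (use v_in_V in auto)

text \<open>
  The left interface functions at cut \<open>k\<close>: nothing has been read yet, the cut lies inside the
  interaction range, or all interacting coordinates have been read. The cut \<open>0\<close> belongs to the first
  case even if the range extends beyond the first coordinate.
\<close>

definition interface :: "nat \<Rightarrow> ((nat \<Rightarrow> real) \<Rightarrow> real) set" where
  "interface k =
    (if k = 0 \<or> k + s1 < l then {\<lambda>_. 1}
     else if k < l + s2 then (\<lambda>j. leading_prod (v j) k) ` {1..N}
     else {f})"

lemma finite_interface [simp]: "finite (interface k)"
  and interface_nonempty [simp]: "interface k \<noteq> {}"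
  using N_pos by (auto simp: interface_def)

lemma card_interface_le: "card (interface k) \<le> N"
  using N_pos card_image_le[of "{1..N}" "\<lambda>j. leading_prod (v j) k"]
  by (auto simp: interface_def)

lemma card_interface_eq_1: "\<not> (l \<le> k + s1 \<and> k < l + s2) \<Longrightarrow> card (interface k) = 1"
  by (auto simp: interface_def)

text \<open>
  This holds also when equation \<open>l\<close> has not started at cut \<open>k\<close>, since a product truncated there is
  the constant \<open>1\<close>.
\<close>

lemma extends_leading_prod:
  assumes "k = 0 \<or> k < l + s2" "j \<in> {1..N}"
  shows "extends V k (interface k) (leading_prod (v j) (Suc k))"
proof -
  have "extends V k (interface k) (\<lambda>x. leading_prod (v j) k x * v j (Suc k) (x (Suc k)))"
  proof (rule extends_mult[OF V_subspace finite_interface _ v_in_V])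
    show "leading_prod (v j) k \<in> interface k"
      using assms v_outside leading_prod_eq_1[of k "v j"] by (auto simp: interface_def)
  qed
  then show ?thesis by (simp add: leading_prod_Suc[abs_def])
qed

lemma extends_self: "u \<in> interface k \<Longrightarrow> extends V k (interface k) u"
  using extends_mult[OF V_subspace finite_interface _ const_in_V, of u k k] by simp

text \<open>
  If \<open>k + 1\<close> is the last interacting position, then the products truncated after it are the complete
  products, and the sum over \<open>j\<close> is absorbed into the core at this position. Beyond that position
  \<open>f\<close> is itself the only interface function.
\<close>

lemma extends_f:
  assumes "k < d" "l + s2 \<le> Suc k \<or> Suc k = d"
  shows "extends V k (interface k) f"
proof (cases "k = 0 \<or> k < l + s2")
  case True
  have "f = (\<lambda>x. \<Sum>j\<in>{1..N}. leading_prod (v j) (Suc k) x)"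
    unfolding decomposition[abs_def] using assms v_outside
    by (intro ext sum.cong refl leading_prod_eqI) auto
  moreover have "extends V k (interface k) (\<lambda>x. \<Sum>j\<in>{1..N}. leading_prod (v j) (Suc k) x)"
    by (rule extends_sum[OF V_subspace extends_leading_prod[OF True]])
  ultimately show ?thesis by argo
next
  case False
  then have "f \<in> interface k" by (auto simp: interface_def)
  then show ?thesis by (rule extends_self)
qed

lemma extends_interface:
  assumes "Suc k < d" "u \<in> interface (Suc k)"
  shows "extends V k (interface k) u"
proof -
  consider "Suc k + s1 < l" "u = (\<lambda>_. 1)"
    | j where "Suc k < l + s2" "j \<in> {1..N}" "u = leading_prod (v j) (Suc k)"
    | "l + s2 \<le> Suc k" "u = f"
    using assms(2) by (auto simp: interface_def split: if_splits)
  then show ?thesis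
  proof cases
    case 1
    then have "u \<in> interface k" by (simp add: interface_def)
    then show ?thesis by (rule extends_self)
  next
    case 2
    then show ?thesis using extends_leading_prod by simp
  next
    case 3
    then show ?thesis using extends_f assms(1) by simp
  qed
qed

lemma ex_tt_representation:
  assumes "is_basis pt \<psi> V"
  shows "\<exists>r A. tt_representation d pt \<psi> f r A \<and>
    (\<forall>k\<in>{1..<d}. if int l - int s1 \<le> int k \<and> int k < int l + int s2 then r k \<le> N else r k = 1)"
proof -
  have d: "d \<ge> 1" using l_range by auto
  obtain A where A: "single_tt_representation d pt \<psi> (\<lambda>_. f) (\<lambda>k. card (interface k)) A"
  proof (rule single_tt_representation_of_interfaces[OF d assms, of interface])
    show "interface 0 = {\<lambda>_. 1}" by (simp add: interface_def)
    show "extends V (d - 1) (interface (d - 1)) f" if "i \<in> {1..d}" for i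
      using extends_f[of "d - 1"] d by simp
  qed (auto intro: extends_interface)
  let ?r = "(\<lambda>k. card (interface k))(d := 1)"
  have "tt_representation d pt \<psi> f ?r (A(d := \<lambda>a i b. A d a i l))"
    by (rule tt_representation_of_single_tt_representation[OF d A l_range])
  moreover have "\<forall>k\<in>{1..<d}. if int l - int s1 \<le> int k \<and> int k < int l + int s2
      then ?r k \<le> N else ?r k = 1"
    using card_interface_le card_interface_eq_1 by auto
  ultimately show ?thesis by blast
qed

end


section \<open>Representations of the whole system\<close>

text \<open>
  The cores are diagonal in \<open>j\<close>, and the first and the last one are a row and a column. The type of
  core \<open>k\<close> in equation \<open>l\<close> is \<open>k - l + s1 + 1\<close> inside the range, so that \<open>l\<close> can be recovered from
  \<open>k\<close> and the type; all positions outside have the type \<open>s1 + s2 + 2\<close>.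
\<close>

lemma ex_selection_representation:
  assumes d: "d \<ge> 1" and N: "N \<ge> 1" and basis: "is_basis pt \<psi> V"
    and v: "\<And>l. l \<in> {1..d} \<Longrightarrow> local_cp_decomposition d N s1 s2 l V (f l) (v l)"
  shows "\<exists>Q r A. selection_representation d pt \<psi> f (s1 + s2 + 2) Q r A \<and> (\<forall>k\<in>{1..<d}. r k \<le> N)"
proof -
  obtain C where C: "\<And>c y. c \<in> V \<Longrightarrow> c y = (\<Sum>i\<in>{1..pt}. C c i * \<psi> i y)"
    using is_basis_coordinates[OF basis] by blast
  define Q where "Q k l = (if l \<le> k + s1 \<and> k \<le> l + s2 then Suc (k + s1) - l else s1 + s2 + 2)" for k l
  define u where "u k t j = (if t \<le> s1 + s2 + 1 then v (Suc (k + s1) - t) j k else (\<lambda>_. 1))" for k t j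
  define r where "r k = (if k = 0 \<or> k = d then 1 else N)" for k
  \<comment> \<open>The terms \<open>j\<close> that pass through the entry \<open>(a, b)\<close> of core \<open>k\<close>. The rank indices at the cuts
    \<open>0\<close> and \<open>d\<close> do not constrain \<open>j\<close>; the sum over \<open>j\<close> is thus taken in the last core.\<close>
  define J where "J k a b = {j\<in>{1..N}. (k \<noteq> 1 \<longrightarrow> j = a) \<and> (k \<noteq> d \<longrightarrow> j = b)}" for k a b
  define A where "A k a i t b = (\<Sum>j\<in>J k a b. C (u k t j) i)" for k a i t b
  have Q: "Q k l \<in> {1..s1 + s2 + 2}" for k l
    by (auto simp: Q_def)
  have "is_coeff_tensor d pt \<psi> (f l) (tt_contraction d r (\<lambda>k a i b. A k a i (Q k l) b))"
    if l: "l \<in> {1..d}" for l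
  proof -
    interpret local_cp_decomposition d N s1 s2 l V "f l" "v l"
      using v[OF l] .
    have u: "u k (Q k l) j = v l j k" for k j
      using v_outside[of k j] by (auto simp: u_def Q_def)
    have core: "(\<Sum>i\<in>{1..pt}. A k a i (Q k l) b * \<psi> i y) = (\<Sum>j\<in>J k a b. v l j k y)" for k a b y
      using C[OF v_in_V] by (simp add: A_def u sum_distrib_right sum.swap[of _ "{Suc 0..pt}"])
    show ?thesis
    proof (rule is_coeff_tensor_tt_contraction[where
          U = "\<lambda>k b. if k = d then f l else leading_prod (v l b) k"], unfold core)
      fix k b x assume k: "k < d" and b: "b \<in> {1..r (Suc k)}"
      have "(\<Sum>a\<in>{1..r k}. leading_prod (v l a) k x * (\<Sum>j\<in>J (Suc k) a b. v l j (Suc k) (x (Suc k)))) =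
          (\<Sum>j\<in>(if Suc k = d then {1..N} else {b}). leading_prod (v l j) (Suc k) x)"
      proof (cases "k = 0")
        case True
        have "J (Suc 0) a b = (if d = 1 then {1..N} else {b})" for a
          using b True by (auto simp: J_def r_def)
        then show ?thesis using True by (simp add: r_def leading_prod_Suc)
      next
        case False
        have "J (Suc k) a b = (if Suc k = d \<or> a = b then {a} else {})" if "a \<in> {1..N}" for a
          using that False by (auto simp: J_def)
        then have "(\<Sum>a\<in>{1..N}. leading_prod (v l a) k x * (\<Sum>j\<in>J (Suc k) a b. v l j (Suc k) (x (Suc k)))) =
            (\<Sum>a\<in>{1..N}. if Suc k = d \<or> a = b then leading_prod (v l a) (Suc k) x else 0)"
          by (intro sum.cong refl) (simp add: leading_prod_Suc)
        then show ?thesis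
          using b k False by (auto simp: r_def split: if_splits)
      qed
      then show "(if Suc k = d then f l else leading_prod (v l b) (Suc k)) x =
          (\<Sum>a\<in>{1..r k}. (if k = d then f l else leading_prod (v l a) k) x *
             (\<Sum>j\<in>J (Suc k) a b. v l j (Suc k) (x (Suc k))))"
        using k by (auto simp: decomposition)
    qed (use d in \<open>auto simp: r_def\<close>)
  qed
  moreover have "selection_contraction d (s1 + s2 + 2) r A (selection_tensor d Q) l =
      tt_contraction d r (\<lambda>k a i b. A k a i (Q k l) b)" if "l \<in> {1..d}" for l
    using Q that by (intro ext) (simp add: selection_contraction_eq tt_contraction_def del: atLeastAtMost_iff)
  ultimately have "selection_representation d pt \<psi> f (s1 + s2 + 2) Q r A"
    using Q N by (simp add: selection_representation_def r_def)
  moreover have "\<forall>k\<in>{1..<d}. r k \<le> N" by (simp add: r_def)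
  ultimately show ?thesis by blast
qed

text \<open>
  The interfaces of all equations are merged. Every combination that served one equation serves in
  the union, and what remains is to count.
\<close>

lemma ex_single_tt_representation:
  assumes d: "d \<ge> 1" and N: "N \<ge> 1" and basis: "is_basis pt \<psi> V"
    and v: "\<And>l. l \<in> {1..d} \<Longrightarrow> local_cp_decomposition d N s1 s2 l V (f l) (v l)"
  shows "\<exists>r A. single_tt_representation d pt \<psi> f r A \<and>
    (\<forall>k\<in>{1..<d}. int (r k) \<le> int k - int s2 + 1 + int N * (int s1 + int s2))"
proof -
  let ?w = "\<lambda>l. local_cp_decomposition.interface N s1 s2 l (f l) (v l)"
  define W where "W k = insert (\<lambda>_. 1) (\<Union>l\<in>{1..d}. ?w l k)" for k
  note interface_def = local_cp_decomposition.interface_def[OF v]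
  have fin_w: "finite (?w l k)" if "l \<in> {1..d}" for l k
    using local_cp_decomposition.finite_interface[OF v[OF that]] .
  have fin: "finite (W k)" for k
    using fin_w by (auto simp: W_def)
  have sub: "subspace V" and one: "(\<lambda>_. 1) \<in> V"
    using v[of 1] d by (auto simp: local_cp_decomposition_def)
  have mono: "extends V k (W k) u" if "l \<in> {1..d}" "extends V k (?w l k) u" for k l u
    using sub that(2) by (rule extends_mono) (use that fin in \<open>auto simp: W_def\<close>)
  obtain A where A: "single_tt_representation d pt \<psi> f (\<lambda>k. card (W k)) A"
  proof (rule single_tt_representation_of_interfaces[OF d basis, of W])
    show "W 0 = {\<lambda>_. 1}"
      using d by (auto simp: W_def interface_def)
    show "finite (W k) \<and> W k \<noteq> {}" for k
      using fin by (auto simp: W_def)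
    show "extends V k (W k) u" if k: "Suc k < d" and u: "u \<in> W (Suc k)" for k u
    proof -
      consider "u = (\<lambda>_. 1)" | l where "l \<in> {1..d}" "u \<in> ?w l (Suc k)"
        using u unfolding W_def by blast
      then show ?thesis
      proof cases
        case 1
        then show ?thesis
          using extends_mult[OF sub fin _ one, of "\<lambda>_. 1" k k] by (simp add: W_def)
      next
        case 2
        then show ?thesis
          using mono local_cp_decomposition.extends_interface[OF v] k by blast
      qed
    qed
    show "extends V (d - 1) (W (d - 1)) (f l)" if "l \<in> {1..d}" for l
      using that d by (intro mono[OF that] local_cp_decomposition.extends_f[OF v]) auto
  qed
  moreover have "int (card (W k)) \<le> int k - int s2 + 1 + int N * (int s1 + int s2)" for k
  proof -
    \<comment> \<open>Contains every equation whose interface at cut \<open>k\<close> may differ from \<open>{1}\<close> and \<open>{f l}\<close>.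
      Subtraction truncates at \<open>0\<close>, as no equation is finished when \<open>k < s2\<close>.\<close>
    let ?open = "{k - s2<..k + s1} \<inter> {1..d}"
    have closed: "?w l k \<subseteq> insert (\<lambda>_. 1) (f ` {1..k - s2})" if "l \<in> {1..d}" "l \<notin> ?open" for l
      using that by (auto simp: interface_def)
    have "W k \<subseteq> insert (\<lambda>_. 1) (f ` {1..k - s2} \<union> (\<Union>l\<in>?open. ?w l k))"
      unfolding W_def using closed by blast
    then have "card (W k) \<le> card (insert (\<lambda>_. 1) (f ` {1..k - s2} \<union> (\<Union>l\<in>?open. ?w l k)))"
      using fin_w by (intro card_mono) auto
    also have "\<dots> \<le> Suc (card (f ` {1..k - s2} \<union> (\<Union>l\<in>?open. ?w l k)))"
      by (rule card_insert_le_m1) auto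
    also have "card (f ` {1..k - s2} \<union> (\<Union>l\<in>?open. ?w l k)) \<le>
        card (f ` {1..k - s2}) + card (\<Union>l\<in>?open. ?w l k)"
      by (rule card_Un_le)
    also have "card (f ` {1..k - s2}) \<le> k - s2"
      using card_image_le[of "{1..k - s2}" f] by simp
    also have "card (\<Union>l\<in>?open. ?w l k) \<le> (\<Sum>l\<in>?open. card (?w l k))"
      by (rule card_UN_le) simp
    also have "\<dots> \<le> card ?open * N"
      using sum_bounded_above[of ?open "\<lambda>l. card (?w l k)" N]
        local_cp_decomposition.card_interface_le[OF v] by simp
    also have "card ?open \<le> k + s1 - (k - s2)"
      using card_mono[of "{k - s2<..k + s1}" ?open] by simp
    finally have card: "card (W k) \<le> Suc (k - s2 + (k + s1 - (k - s2)) * N)" by simp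
    show ?thesis
    proof (cases "s2 \<le> k")
      case True
      then have "k + s1 - (k - s2) = s1 + s2" by simp
      then have "int (card (W k)) \<le> int (Suc (k - s2 + (s1 + s2) * N))"
        using card by presburger
      then show ?thesis using True by (simp add: of_nat_diff algebra_simps)
    next
      case False
      then have "int (card (W k)) \<le> int (Suc ((k + s1) * N))"
        using card by (simp only: of_nat_le_iff) simp
      moreover have "int (s2 - k) * 1 \<le> int (s2 - k) * int N"
        using N by (intro mult_left_mono) auto
      ultimately show ?thesis using False by (simp add: of_nat_diff algebra_simps)
    qed
  qed
  ultimately show ?thesis by blast
qed

theorem theorem5:
  fixes d N s1 s2 p pt :: nat
    and g \<psi> :: "nat \<Rightarrow> real \<Rightarrow> real"
    and f :: "nat \<Rightarrow> (nat \<Rightarrow> real) \<Rightarrow> real"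
    and V :: "(real \<Rightarrow> real) set"
  assumes "d \<ge> 1" and "N \<ge> 1"
    and "one_dim_governing d N s1 s2 p g f"
    and "V = leg_space p g"
    and "is_basis pt \<psi> V"
  shows
    "(\<forall>l\<in>{1..d}. f l \<in> tensor_power d V) \<and>
     (\<forall>l\<in>{1..d}. cp_rank d V (f l) \<le> N) \<and>
     (\<forall>l\<in>{1..d}. \<exists>r A. tt_representation d pt \<psi> (f l) r A \<and>
        (\<forall>k\<in>{1..<d}. if int l - int s1 \<le> int k \<and> int k < int l + int s2 then r k \<le> N else r k = 1)) \<and>
     (\<exists>Q r A. selection_representation d pt \<psi> f (s1 + s2 + 2) Q r A \<and>
        (\<forall>k\<in>{1..<d}. r k \<le> N)) \<and>
     (\<exists>r A. single_tt_representation d pt \<psi> f r A \<and>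
        (\<forall>k\<in>{1..<d}. int (r k) \<le> int k - int s2 + 1 + int N * (int s1 + int s2)))"
proof -
  have "\<exists>v. local_cp_decomposition d N s1 s2 l V (f l) v" if "l \<in> {1..d}" for l
    using ex_local_cp_decomposition assms that by blast
  then obtain v where v: "\<And>l. l \<in> {1..d} \<Longrightarrow> local_cp_decomposition d N s1 s2 l V (f l) (v l)"
    by metis
  show ?thesis
    using local_cp_decomposition.in_tensor_power[OF v] local_cp_decomposition.cp_rank_le[OF v]
      local_cp_decomposition.ex_tt_representation[OF v assms(5)]
      ex_selection_representation[OF assms(1,2,5) v] ex_single_tt_representation[OF assms(1,2,5) v]
    by (intro conjI ballI) blast+
qed

end
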